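(* Let $P$, $\{\widehat P_k\}_{k\ge1}$, $V$, $\pi$, $\widehat\pi_k$, $\phi_k$ be as in the context. Assume that there exist $\delta\in(0,1)$ and $L>0$ such that $PV\le \delta V+L\,1_{\mathbb X}$ and $\widehat P_kV\le\delta V+L\,1_{\mathbb X}$ for every $k\ge 1$. Set $\Delta_k:=\|\widehat P_k-P\|_{0,1}$ and $A:=1+\frac{L}{1-\delta}$. (a) If, for some $k\ge1$, $\widehat P_k$ is $V$-geometrically ergodic with rate $\rho_k\in(0,1)$ and constant $C_k>0$, then $$\|\widehat\pi_k-\pi\|_{TV}\ \le\ \widehat\pi_k(1_{\mathbb X})\,|1-\pi(\phi_k)|+\frac{L}{1-\delta}\left(\frac{2C_k}{\rho_k}+\frac{A}{\ln(\rho_k^{-1})}\,|\ln\Delta_k|\right)\Delta_k .$$ (b) If $P$ is $V$-geometrically ergodic with rate $\rho\in(0,1)$ and constant $C>0$, then for every $n\ge1$ $$\|\widehat\pi_n-\pi\|_{TV}\ \le\ |1-\widehat\pi_n(1_{\mathbb X})|+\frac{L}{1-\delta}\left(\frac{2C}{\rho}+\frac{A}{\ln(\rho^{-1})}\,|\ln\Delta_n|\right)\Delta_n .$$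
   Context: Setting. $(\mathbb X,\mathcal X)$ is a measurable space and $V:\mathbb X\to[1,+\infty)$ is measurable with $V(x_0)=1$ for some $x_0\in\mathbb X$. $\mathcal B_1$ is the Banach space of measurable $f:\mathbb X\to\mathbb C$ with $\|f\|_1:=\sup_{x}|f(x)|/V(x)<\infty$; $\mathcal B_0$ is the Banach space of bounded measurable $f:\mathbb X\to\mathbb C$ with $\|f\|_0:=\sup_x|f(x)|$. For a linear map $T:\mathcal B_0\to\mathcal B_1$, $\|T\|_{0,1}:=\sup\{\|Tf\|_1: f\in\mathcal B_0,\|f\|_0\le1\}$; $\|T\|_1$ also denotes the operator norm on $\mathcal B_1$. For a positive measure $\mu$, $\mu(f):=\int f\,d\mu$. A kernel $K$ acts by $(Kf)(x)=\int f(y)K(x,dy)$. Standing assumptions. $P$ is a Markov kernel and $\{\widehat P_k\}_{k\ge1}$ is a sequence of nonnegative sub-Markov kernels on $(\mathbb X,\mathcal X)$; $PV/V$ and each $\widehat P_kV/V$ are bounded on $\mathbb X$. $P$ has an invariant probability measure $\pi$ with $\pi(V)<\infty$; each $\widehat P_k$ has an invariant bounded positive measure $\widehat\pi_k$ with $\widehat\pi_k(V)<\infty$, and there is a bounded measurable $\phi_k:\mathbb X\to[0,+\infty)$ with $\widehat P_k\phi_k=\phi_k$ and $\widehat\pi_k(\phi_k)=1$. Each $\widehat P_k$ has finite rank on $\mathcal B_1$; $\lim_k\|\widehat P_k-P\|_{0,1}=0$; $\lim_k\pi(\phi_k)=1$ and $\lim_k\widehat\pi_k(1_{\mathbb X})=1$.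 $P$ is $V$-geometrically ergodic with rate $\rho\in(0,1)$ and constant $C>0$ if $\sup_{\|f\|_1\le1}\|P^nf-\pi(f)1_{\mathbb X}\|_1\le C\rho^n$ for all $n\ge0$. $\widehat P_k$ is $V$-geometrically ergodic with rate $\rho_k\in(0,1)$ and constant $C_k>0$ if $\sup_{\|f\|_1\le1}\|\widehat P_k^{\,n}f-\widehat\pi_k(f)\phi_k\|_1\le C_k\rho_k^n$ for all $n\ge0$. $\|\widehat\pi_k-\pi\|_{TV}:=\sup_{\|f\|_0\le1}|\widehat\pi_k(f)-\pi(f)|$. Convention: $|\ln 0|\cdot 0=0$. *)

theory Defs
  imports "HOL-Probability.Probability"
begin

text \<open>
  Suprema are taken in \<^typ>\<open>ennreal\<close>, so that they are meaningful without a
  prior boundedness proof. The weight \<^term>\<open>V\<close> gives the norm with index 1, the constant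
  weight \<^term>\<open>1 :: real\<close> the norm with index 0. Only values on \<^term>\<open>space M\<close> matter:
  functions that agree there represent the same element.
\<close>

definition wnorm :: "'a measure \<Rightarrow> ('a \<Rightarrow> real) \<Rightarrow> ('a \<Rightarrow> complex) \<Rightarrow> ennreal" where
  "wnorm M W f = (SUP x\<in>space M. ennreal (cmod (f x) / W x))"

definition wspace :: "'a measure \<Rightarrow> ('a \<Rightarrow> real) \<Rightarrow> ('a \<Rightarrow> complex) set" where
  "wspace M W = {f \<in> borel_measurable M. wnorm M W f < \<infinity>}"

definition wball :: "'a measure \<Rightarrow> ('a \<Rightarrow> real) \<Rightarrow> ('a \<Rightarrow> complex) set" where
  "wball M W = {f \<in> wspace M W. wnorm M W f \<le> 1}"

text \<open>The norm of an operator from the space with weight \<^term>\<open>U\<close> to that with weight \<^term>\<open>W\<close>.\<close>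

definition wopnorm ::
  "'a measure \<Rightarrow> ('a \<Rightarrow> real) \<Rightarrow> ('a \<Rightarrow> real) \<Rightarrow> (('a \<Rightarrow> complex) \<Rightarrow> ('a \<Rightarrow> complex)) \<Rightarrow> ennreal" where
  "wopnorm M U W T = (SUP f\<in>wball M U. wnorm M W (T f))"

definition kact ::
  "('a \<Rightarrow> 'a measure) \<Rightarrow> ('a \<Rightarrow> 'b::{banach, second_countable_topology}) \<Rightarrow> 'a \<Rightarrow> 'b" where
  "kact K f x = (\<integral>y. f y \<partial>K x)"

definition invariant_measure :: "'a measure \<Rightarrow> ('a \<Rightarrow> 'a measure) \<Rightarrow> 'a measure \<Rightarrow> bool" where
  "invariant_measure M K \<mu> \<longleftrightarrow>
     sets \<mu> = sets M \<and> (\<forall>A\<in>sets M. (\<integral>\<^sup>+x. emeasure (K x) A \<partial>\<mu>) = emeasure \<mu> A)"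

text \<open>The range of the operator on the space with weight \<^term>\<open>W\<close> lies in the complex span of
  finitely many elements of that space.\<close>

definition finite_rank ::
  "'a measure \<Rightarrow> ('a \<Rightarrow> real) \<Rightarrow> (('a \<Rightarrow> complex) \<Rightarrow> ('a \<Rightarrow> complex)) \<Rightarrow> bool" where
  "finite_rank M W T \<longleftrightarrow>
     (\<exists>G. finite G \<and> G \<subseteq> wspace M W \<and>
        (\<forall>f\<in>wspace M W. \<exists>c :: ('a \<Rightarrow> complex) \<Rightarrow> complex.
           \<forall>x\<in>space M. T f x = (\<Sum>g\<in>G. c g * g x)))"

text \<open>Geometric ergodicity towards the rank-one operator \<open>f \<mapsto> \<mu>(f) \<phi>\<close>;
  for a Markov kernel \<open>\<phi>\<close> is the constant function 1.\<close>

definition geom_ergodic ::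
  "'a measure \<Rightarrow> ('a \<Rightarrow> real) \<Rightarrow> ('a \<Rightarrow> 'a measure) \<Rightarrow> 'a measure \<Rightarrow> ('a \<Rightarrow> real) \<Rightarrow> real \<Rightarrow> real \<Rightarrow> bool" where
  "geom_ergodic M V K \<mu> \<phi> \<rho> C \<longleftrightarrow>
     0 < \<rho> \<and> \<rho> < 1 \<and> 0 < C \<and>
     (\<forall>n. wopnorm M V V (\<lambda>f x. (kact K ^^ n) f x - (\<integral>y. f y \<partial>\<mu>) * complex_of_real (\<phi> x))
            \<le> ennreal (C * \<rho> ^ n))"

text \<open>The normalization is the functional one, a supremum over the whole unit ball of bounded
  measurable functions, without a factor 1/2.\<close>

definition tv_norm_diff :: "'a measure \<Rightarrow> 'a measure \<Rightarrow> 'a measure \<Rightarrow> ennreal" where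
  "tv_norm_diff M \<mu> \<nu> =
     (SUP f\<in>wball M (\<lambda>_. 1). ennreal (cmod ((\<integral>x. f x \<partial>\<mu>) - (\<integral>x. f x \<partial>\<nu>))))"

text \<open>The difference \<open>K - K'\<close> of two kernels as an operator from index 0 to index 1.\<close>

definition kdist :: "'a measure \<Rightarrow> ('a \<Rightarrow> real) \<Rightarrow> ('a \<Rightarrow> 'a measure) \<Rightarrow> ('a \<Rightarrow> 'a measure) \<Rightarrow> ennreal" where
  "kdist M V K K' = wopnorm M (\<lambda>_. 1) V (\<lambda>f x. kact K f x - kact K' f x)"

text \<open>For sub-Markov kernels and \<open>V \<ge> 1\<close> the distance is finite, so that
  \<^const>\<open>enn2real\<close> loses nothing when it is used in real arithmetic.\<close>

lemma kdist_le_2: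
  assumes K: "K \<in> M \<rightarrow>\<^sub>M subprob_algebra M" and K': "K' \<in> M \<rightarrow>\<^sub>M subprob_algebra M"
    and V: "\<And>x. x \<in> space M \<Longrightarrow> 1 \<le> V x"
  shows "kdist M V K K' \<le> 2"
proof -
  have bound: "cmod (kact Q f x) \<le> 1"
    if Q: "Q \<in> M \<rightarrow>\<^sub>M subprob_algebra M" and f: "f \<in> wball M (\<lambda>_. 1)" and x: "x \<in> space M" for Q f x
  proof -
    interpret subprob_space "Q x"
      using measurable_space[OF Q x] by (simp add: space_subprob_algebra)
    have sp: "space (Q x) = space M"
      using measurable_space[OF Q x]
      by (intro sets_eq_imp_space_eq) (simp add: space_subprob_algebra)
    have le: "cmod (f y) \<le> 1" if y: "y \<in> space M" for y
    proof -
      have "ennreal (cmod (f y) / 1) \<le> wnorm M (\<lambda>_. 1) f"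
        unfolding wnorm_def by (rule SUP_upper[OF y])
      also have "\<dots> \<le> 1" using f unfolding wball_def by blast
      finally show ?thesis by simp
    qed
    have "cmod (kact Q f x) \<le> (\<integral>y. cmod (f y) \<partial>Q x)"
      unfolding kact_def by (rule integral_norm_bound)
    also have "\<dots> \<le> (\<integral>y. 1 \<partial>Q x)"
      by (rule integral_mono') (simp_all add: sp le)
    also have "\<dots> = measure (Q x) (space (Q x))" by simp
    also have "\<dots> \<le> 1" by (rule subprob_measure_le_1)
    finally show ?thesis .
  qed
  have "ennreal (cmod (kact K f x - kact K' f x) / V x) \<le> 2"
    if f: "f \<in> wball M (\<lambda>_. 1)" and x: "x \<in> space M" for f x
  proof -
    have "cmod (kact K f x - kact K' f x) \<le> 2 * V x"
      using norm_triangle_ineq4[of "kact K f x" "kact K' f x"]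
        bound[OF K f x] bound[OF K' f x] V[OF x] by linarith
    then have "cmod (kact K f x - kact K' f x) / V x \<le> 2"
      using V[OF x] by (simp add: divide_le_eq)
    then have "ennreal (cmod (kact K f x - kact K' f x) / V x) \<le> ennreal 2"
      by (rule ennreal_leI)
    then show ?thesis by simp
  qed
  then show ?thesis
    unfolding kdist_def wopnorm_def wnorm_def by (intro SUP_least)
qed

end

theory Submission
  imports Defs
begin

text \<open>
  Both bounds are instances of one perturbation argument. Let \<open>K\<close> and \<open>Q\<close> be sub-Markov kernels,
  let \<open>\<nu>\<close> be a finite measure invariant under \<open>K\<close>, and let \<open>Q\<close> be \<open>V\<close>-geometrically ergodic
  with limit \<open>f \<mapsto> \<mu>(f) \<psi>\<close>. For \<open>\<bar>f\<bar> \<le> 1\<close> and every \<open>m\<close>,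
  \<open>\<nu>(f) - \<mu>(f) \<nu>(\<psi>) = (\<nu>(f) - \<nu>(Q^m f)) + \<nu>(Q^m f - \<mu>(f) \<psi>)\<close>.

  In the first bracket, \<open>\<nu>(Q^j f) - \<nu>(Q^(j+1) f) = \<nu>((K - Q) Q^j f)\<close> by invariance, and \<open>Q^j f\<close> is
  still bounded by 1, so each of the \<open>m\<close> steps costs at most \<open>\<Delta> \<nu>(V)\<close>, where \<open>\<Delta>\<close> is the
  distance of \<open>K\<close> and \<open>Q\<close> (\<open>invariant_measure_power_diff\<close>). The second bracket is at most
  \<open>C \<rho>^m \<nu>(V)\<close> by ergodicity. Hence \<open>\<bar>\<nu>(f) - \<mu>(f) \<nu>(\<psi>)\<bar> \<le> (m \<Delta> + C \<rho>^m) \<nu>(V)\<close>, and choosing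
  \<open>m\<close> about \<open>ln \<Delta> / ln \<rho>\<close> makes both terms of order \<open>\<Delta> \<bar>ln \<Delta>\<bar>\<close>
  (\<open>optimal_number_of_steps\<close>). Integrating the drift inequality against an invariant measure
  gives \<open>\<nu>(V) \<le> L / (1 - \<delta>) * \<nu>(1)\<close> (\<open>invariant_measure_drift\<close>), which explains the factor
  \<open>L / (1 - \<delta>)\<close>.

  In (a) the ergodic kernel \<open>Q\<close> is the perturbed one and \<open>\<nu> = \<pi>\<close>; in (b) the roles are exchanged,
  so that \<open>\<nu>\<close> is the perturbed invariant measure. The remaining term in each bound is the error
  made by replacing \<open>\<pi>(\<phi>\<^sub>k)\<close>, respectively the mass of the perturbed measure, by 1. In (b) that
  mass also enters through \<open>\<nu>(V)\<close>; it is removed by comparing \<open>\<pi>\<close> with the normalized measure.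
\<close>

section \<open>Weighted unit balls\<close>

lemma wball_iff:
  assumes W: "\<And>x. x \<in> space M \<Longrightarrow> 0 < W x"
  shows "f \<in> wball M W \<longleftrightarrow> f \<in> borel_measurable M \<and> (\<forall>x\<in>space M. cmod (f x) \<le> W x)"
proof -
  have "wnorm M W f \<le> 1 \<longleftrightarrow> (\<forall>x\<in>space M. cmod (f x) \<le> W x)"
    unfolding wnorm_def by (auto simp: SUP_le_iff W divide_le_eq)
  then show ?thesis
    unfolding wball_def wspace_def by (auto intro: le_less_trans)
qed

lemma wball_1_iff:
  "f \<in> wball M (\<lambda>_. 1) \<longleftrightarrow> f \<in> borel_measurable M \<and> (\<forall>x\<in>space M. cmod (f x) \<le> 1)"
  by (rule wball_iff) simp

lemma wopnorm_le_imp: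
  assumes "wopnorm M U W T \<le> ennreal B" "f \<in> wball M U" "x \<in> space M" "0 < W x" "0 \<le> B"
  shows "cmod (T f x) \<le> B * W x"
proof -
  have "ennreal (cmod (T f x) / W x) \<le> wnorm M W (T f)"
    unfolding wnorm_def by (rule SUP_upper[OF assms(3)])
  also have "\<dots> \<le> wopnorm M U W T"
    unfolding wopnorm_def by (rule SUP_upper[OF assms(2)])
  also note assms(1)
  finally show ?thesis using assms(4,5) by (simp add: divide_le_eq)
qed

lemma kdist_commute: "kdist M V K Q = kdist M V Q K"
  unfolding kdist_def wopnorm_def wnorm_def by (simp add: norm_minus_commute)

section \<open>Kernels acting on bounded functions\<close>

lemma kact_wball:
  assumes Q: "Q \<in> M \<rightarrow>\<^sub>M subprob_algebra M" and f: "f \<in> wball M (\<lambda>_. 1)"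
  shows "kact Q f \<in> wball M (\<lambda>_. 1)"
  unfolding wball_1_iff
proof (intro conjI ballI)
  have fm: "f \<in> borel_measurable M" using f unfolding wball_1_iff by blast
  show "kact Q f \<in> borel_measurable M"
    unfolding kact_def
    by (rule measurable_compose[OF Q integral_measurable_subprob_algebra[OF fm]])
next
  fix x assume x: "x \<in> space M"
  interpret subprob_space "Q x"
    using measurable_space[OF Q x] by (simp add: space_subprob_algebra)
  have "cmod (kact Q f x) \<le> (\<integral>y. cmod (f y) \<partial>Q x)"
    unfolding kact_def by (rule integral_norm_bound)
  also have "\<dots> \<le> (\<integral>y. 1 \<partial>Q x)"
    using f by (intro integral_mono') (simp_all add: subprob_measurableD(1)[OF Q x] wball_1_iff)
  also have "\<dots> = measure (Q x) (space (Q x))" by simp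
  also have "\<dots> \<le> 1" by (rule subprob_measure_le_1)
  finally show "cmod (kact Q f x) \<le> 1" .
qed

lemma kact_funpow_wball:
  assumes Q: "Q \<in> M \<rightarrow>\<^sub>M subprob_algebra M" and f: "f \<in> wball M (\<lambda>_. 1)"
  shows "(kact Q ^^ n) f \<in> wball M (\<lambda>_. 1)"
  by (induction n) (simp_all add: f kact_wball[OF Q])

lemma kact_diff_le_kdist:
  assumes K: "K \<in> M \<rightarrow>\<^sub>M subprob_algebra M" and Q: "Q \<in> M \<rightarrow>\<^sub>M subprob_algebra M"
    and V: "\<And>x. x \<in> space M \<Longrightarrow> 1 \<le> V x"
    and f: "f \<in> wball M (\<lambda>_. 1)" and x: "x \<in> space M"
  shows "cmod (kact K f x - kact Q f x) \<le> enn2real (kdist M V K Q) * V x"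
proof -
  have "kdist M V K Q \<le> 2" by (rule kdist_le_2[OF K Q V])
  then have "kdist M V K Q < top" by (rule le_less_trans) simp
  then have "wopnorm M (\<lambda>_. 1) V (\<lambda>f x. kact K f x - kact Q f x)
               \<le> ennreal (enn2real (kdist M V K Q))"
    by (simp add: kdist_def)
  from wopnorm_le_imp[OF this f x] show ?thesis using V[OF x] by simp
qed

section \<open>Invariant measures\<close>

lemma norm_integral_le_integral:
  fixes f :: "'a \<Rightarrow> 'b::{banach, second_countable_topology}"
  assumes "integrable \<nu> f" "integrable \<nu> g" "\<And>x. x \<in> space \<nu> \<Longrightarrow> norm (f x) \<le> g x"
  shows "norm (\<integral>x. f x \<partial>\<nu>) \<le> (\<integral>x. g x \<partial>\<nu>)"
proof -
  have "norm (\<integral>x. f x \<partial>\<nu>) \<le> (\<integral>x. norm (f x) \<partial>\<nu>)" by (rule integral_norm_bound)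
  also have "\<dots> \<le> (\<integral>x. g x \<partial>\<nu>)" using assms by (intro integral_mono) auto
  finally show ?thesis .
qed

text \<open>
  Invariance as a fixed-point equation in the Giry monad, which passes from sets to integrands
  through \<open>nn_integral_bind\<close> and \<open>integral_bind\<close>.
\<close>

lemma invariant_measure_bind:
  assumes K: "K \<in> M \<rightarrow>\<^sub>M subprob_algebra M" and inv: "invariant_measure M K \<nu>"
    and ne: "space M \<noteq> {}"
  shows "\<nu> \<bind> K = \<nu>"
proof (rule measure_eqI)
  have s: "sets \<nu> = sets M" using inv by (simp add: invariant_measure_def)
  have sp: "space \<nu> = space M" by (rule sets_eq_imp_space_eq[OF s])
  have K\<nu>: "K \<in> \<nu> \<rightarrow>\<^sub>M subprob_algebra M" using K by (simp add: measurable_cong_sets[OF s refl])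
  show eq: "sets (\<nu> \<bind> K) = sets \<nu>"
    using ne subprob_measurableD(2)[OF K] by (subst sets_bind[where N=M]) (auto simp: s sp)
  show "emeasure (\<nu> \<bind> K) A = emeasure \<nu> A" if "A \<in> sets (\<nu> \<bind> K)" for A
    using that inv ne by (simp add: eq emeasure_bind[OF _ K\<nu>] s sp invariant_measure_def)
qed

lemma invariant_measure_nn_integral:
  assumes K: "K \<in> M \<rightarrow>\<^sub>M subprob_algebra M" and inv: "invariant_measure M K \<nu>"
    and ne: "space M \<noteq> {}" and f: "f \<in> borel_measurable M"
  shows "(\<integral>\<^sup>+x. \<integral>\<^sup>+y. f y \<partial>K x \<partial>\<nu>) = (\<integral>\<^sup>+x. f x \<partial>\<nu>)"
proof -
  have s: "sets \<nu> = sets M" using inv by (simp add: invariant_measure_def)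
  have "K \<in> \<nu> \<rightarrow>\<^sub>M subprob_algebra M" using K by (simp add: measurable_cong_sets[OF s refl])
  from nn_integral_bind[OF f this] show ?thesis
    by (simp add: invariant_measure_bind[OF K inv ne])
qed

lemma wball_integrable:
  assumes fin: "finite_measure \<nu>" and s: "sets \<nu> = sets M" and f: "f \<in> wball M (\<lambda>_. 1)"
  shows "integrable \<nu> f"
proof (rule finite_measure.integrable_const_bound[OF fin])
  show "f \<in> borel_measurable \<nu>"
    using f unfolding wball_1_iff measurable_cong_sets[OF s refl] by blast
  show "AE x in \<nu>. cmod (f x) \<le> 1"
    using f by (intro AE_I2) (simp add: wball_1_iff sets_eq_imp_space_eq[OF s])
qed

lemma invariant_measure_integral:
  assumes K: "K \<in> M \<rightarrow>\<^sub>M subprob_algebra M" and inv: "invariant_measure M K \<nu>"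
    and ne: "space M \<noteq> {}" and fin: "finite_measure \<nu>" and f: "f \<in> wball M (\<lambda>_. 1)"
  shows "(\<integral>x. kact K f x \<partial>\<nu>) = (\<integral>x. f x \<partial>\<nu>)"
proof -
  have s: "sets \<nu> = sets M" using inv by (simp add: invariant_measure_def)
  have sp: "space \<nu> = space M" by (rule sets_eq_imp_space_eq[OF s])
  have K\<nu>: "K \<in> \<nu> \<rightarrow>\<^sub>M subprob_algebra M" using K by (simp add: measurable_cong_sets[OF s refl])
  have fm: "f \<in> borel_measurable M" and fb: "\<And>x. x \<in> space M \<Longrightarrow> cmod (f x) \<le> 1"
    using f unfolding wball_1_iff by blast+
  have sub: "subprob_space (K x)" if "x \<in> space M" for x
    using measurable_space[OF K that] by (simp add: space_subprob_algebra)
  have real_case: "(\<integral>x. (\<integral>y. g y \<partial>K x) \<partial>\<nu>) = (\<integral>x. g x \<partial>\<nu>)"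
    if g: "g \<in> borel_measurable M" "\<And>x. x \<in> space M \<Longrightarrow> \<bar>g x\<bar> \<le> 1" for g :: "'a \<Rightarrow> real"
  proof -
    have "AE x in \<nu>. emeasure (K x) (space (K x)) \<le> ennreal 1"
      using subprob_space.emeasure_space_le_1[OF sub] by (intro AE_I2) (simp add: sp)
    from integral_bind[OF g K\<nu> fin this] show ?thesis
      by (simp add: invariant_measure_bind[OF K inv ne])
  qed
  have fK: "integrable (K x) f" if x: "x \<in> space M" for x
    using subprob_measurableD(2)[OF K x] f sub[OF x]
    by (intro wball_integrable) (auto simp: subprob_space_def)
  have iK: "integrable \<nu> (kact K f)" by (rule wball_integrable[OF fin s kact_wball[OF K f]])
  have if': "integrable \<nu> f" by (rule wball_integrable[OF fin s f])
  \<comment> \<open>Real and imaginary parts are treated separately because \<open>integral_bind\<close> is about real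
    integrands.\<close>
  show ?thesis
  proof (rule complex_eqI)
    have "Re (\<integral>x. kact K f x \<partial>\<nu>) = (\<integral>x. Re (kact K f x) \<partial>\<nu>)" using iK by simp
    also have "\<dots> = (\<integral>x. (\<integral>y. Re (f y) \<partial>K x) \<partial>\<nu>)"
      unfolding kact_def by (intro Bochner_Integration.integral_cong) (simp_all add: sp fK)
    also have "\<dots> = (\<integral>x. Re (f x) \<partial>\<nu>)"
      using fm fb by (intro real_case) (auto intro: order_trans[OF abs_Re_le_cmod])
    also have "\<dots> = Re (\<integral>x. f x \<partial>\<nu>)" using if' by simp
    finally show "Re (\<integral>x. kact K f x \<partial>\<nu>) = Re (\<integral>x. f x \<partial>\<nu>)" .
  next
    have "Im (\<integral>x. kact K f x \<partial>\<nu>) = (\<integral>x. Im (kact K f x) \<partial>\<nu>)" using iK by simp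
    also have "\<dots> = (\<integral>x. (\<integral>y. Im (f y) \<partial>K x) \<partial>\<nu>)"
      unfolding kact_def by (intro Bochner_Integration.integral_cong) (simp_all add: sp fK)
    also have "\<dots> = (\<integral>x. Im (f x) \<partial>\<nu>)"
      using fm fb by (intro real_case) (auto intro: order_trans[OF abs_Im_le_cmod])
    also have "\<dots> = Im (\<integral>x. f x \<partial>\<nu>)" using if' by simp
    finally show "Im (\<integral>x. kact K f x \<partial>\<nu>) = Im (\<integral>x. f x \<partial>\<nu>)" .
  qed
qed

lemma integrable_weight:
  assumes "sets \<nu> = sets M" "V \<in> borel_measurable M" "\<And>x. x \<in> space M \<Longrightarrow> 0 \<le> V x"
    and "(\<integral>\<^sup>+x. ennreal (V x) \<partial>\<nu>) < \<infinity>"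
  shows "integrable \<nu> V"
proof (rule integrableI_nonneg)
  show "V \<in> borel_measurable \<nu>"
    using assms(2) unfolding measurable_cong_sets[OF assms(1) refl] .
  show "AE x in \<nu>. 0 \<le> V x"
    using assms(3) by (intro AE_I2) (simp add: sets_eq_imp_space_eq[OF assms(1)])
qed (rule assms(4))

text \<open>
  Integrating the drift inequality against \<open>\<nu>\<close> gives \<open>\<nu>(V) \<le> \<delta> \<nu>(V) + L \<nu>(1)\<close>, because invariance
  turns the left-hand side into \<open>\<nu>(V)\<close>; finiteness of \<open>\<nu>(V)\<close> allows solving for it.
\<close>

lemma invariant_measure_drift:
  assumes K: "K \<in> M \<rightarrow>\<^sub>M subprob_algebra M" and inv: "invariant_measure M K \<nu>"
    and ne: "space M \<noteq> {}" and fin: "finite_measure \<nu>"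
    and V: "V \<in> borel_measurable M" "\<And>x. x \<in> space M \<Longrightarrow> 0 \<le> V x"
    and VI: "(\<integral>\<^sup>+x. ennreal (V x) \<partial>\<nu>) < \<infinity>"
    and d: "0 \<le> \<delta>" "\<delta> < 1" and L: "0 \<le> L"
    and drift: "\<And>x. x \<in> space M \<Longrightarrow> (\<integral>\<^sup>+y. ennreal (V y) \<partial>K x) \<le> ennreal (\<delta> * V x + L)"
  shows "(\<integral>x. V x \<partial>\<nu>) \<le> L / (1 - \<delta>) * measure \<nu> (space M)"
proof -
  interpret finite_measure \<nu> by (rule fin)
  have s: "sets \<nu> = sets M" using inv by (simp add: invariant_measure_def)
  have sp: "space \<nu> = space M" by (rule sets_eq_imp_space_eq[OF s])
  have VI': "integrable \<nu> V" by (rule integrable_weight[OF s V VI])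
  have "ennreal (\<integral>x. V x \<partial>\<nu>) = (\<integral>\<^sup>+x. ennreal (V x) \<partial>\<nu>)"
    using V(2) by (subst nn_integral_eq_integral[OF VI']) (auto simp: sp)
  also have "\<dots> = (\<integral>\<^sup>+x. \<integral>\<^sup>+y. ennreal (V y) \<partial>K x \<partial>\<nu>)"
    using V(1) by (subst invariant_measure_nn_integral[OF K inv ne]) auto
  also have "\<dots> \<le> (\<integral>\<^sup>+x. ennreal (\<delta> * V x + L) \<partial>\<nu>)"
    by (rule nn_integral_mono) (simp add: sp drift)
  also have "\<dots> = ennreal (\<integral>x. \<delta> * V x + L \<partial>\<nu>)"
    using VI' V(2) d L by (intro nn_integral_eq_integral) (auto simp: sp)
  also have "(\<integral>x. \<delta> * V x + L \<partial>\<nu>) = \<delta> * (\<integral>x. V x \<partial>\<nu>) + L * measure \<nu> (space M)"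
    using VI' by (simp add: sp)
  finally have "(\<integral>x. V x \<partial>\<nu>) \<le> \<delta> * (\<integral>x. V x \<partial>\<nu>) + L * measure \<nu> (space M)"
    using d L V(2) by (subst (asm) ennreal_le_iff) (auto intro!: add_nonneg_nonneg mult_nonneg_nonneg Bochner_Integration.integral_nonneg simp: sp)
  then show ?thesis using d by (simp add: field_simps)
qed

section \<open>Comparison of an invariant measure with the limit of another kernel\<close>

text \<open>
  Replacing one more factor \<open>K\<close> by \<open>Q\<close> costs the same each time: the outer powers of \<open>K\<close> are absorbed
  by \<open>\<nu>\<close>, and the inner powers of \<open>Q\<close> do not increase the supremum norm. The distance bounds
  \<open>(K - Q) g\<close> by a multiple of \<open>V\<close> only, which is why \<open>\<nu>(V)\<close> appears.
\<close>

lemma invariant_measure_power_diff: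
  assumes K: "K \<in> M \<rightarrow>\<^sub>M subprob_algebra M" and Q: "Q \<in> M \<rightarrow>\<^sub>M subprob_algebra M"
    and inv: "invariant_measure M K \<nu>" and ne: "space M \<noteq> {}" and fin: "finite_measure \<nu>"
    and V1: "\<And>x. x \<in> space M \<Longrightarrow> 1 \<le> V x" and VI: "integrable \<nu> V"
    and f: "f \<in> wball M (\<lambda>_. 1)"
  shows "cmod ((\<integral>x. f x \<partial>\<nu>) - (\<integral>x. (kact Q ^^ m) f x \<partial>\<nu>))
           \<le> real m * enn2real (kdist M V K Q) * (\<integral>x. V x \<partial>\<nu>)"
proof (induction m)
  case 0
  show ?case by simp
next
  case (Suc m)
  have s: "sets \<nu> = sets M" using inv by (simp add: invariant_measure_def)
  have sp: "space \<nu> = space M" by (rule sets_eq_imp_space_eq[OF s])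
  let ?D = "enn2real (kdist M V K Q)" and ?g = "(kact Q ^^ m) f"
  have g: "?g \<in> wball M (\<lambda>_. 1)" by (rule kact_funpow_wball[OF Q f])
  have iK: "integrable \<nu> (kact K ?g)" and iQ: "integrable \<nu> (kact Q ?g)"
    using wball_integrable[OF fin s] kact_wball[OF _ g] K Q by blast+
  have "(\<integral>x. ?g x \<partial>\<nu>) - (\<integral>x. kact Q ?g x \<partial>\<nu>) = (\<integral>x. kact K ?g x - kact Q ?g x \<partial>\<nu>)"
    using iK iQ by (simp add: invariant_measure_integral[OF K inv ne fin g])
  also have "cmod \<dots> \<le> (\<integral>x. ?D * V x \<partial>\<nu>)"
    using kact_diff_le_kdist[OF K Q _ g, of V] V1 iK iQ VI
    by (intro norm_integral_le_integral) (auto simp: sp)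
  finally have "cmod ((\<integral>x. ?g x \<partial>\<nu>) - (\<integral>x. kact Q ?g x \<partial>\<nu>)) \<le> ?D * (\<integral>x. V x \<partial>\<nu>)" by simp
  with Suc show ?case
    using norm_triangle_ineq[of "(\<integral>x. f x \<partial>\<nu>) - (\<integral>x. ?g x \<partial>\<nu>)" "(\<integral>x. ?g x \<partial>\<nu>) - (\<integral>x. kact Q ?g x \<partial>\<nu>)"]
    by (simp add: algebra_simps)
qed

text \<open>
  The choice \<open>m = \<lfloor>ln D / ln \<rho>\<rfloor>\<close> gives \<open>\<rho>^m \<le> D / \<rho>\<close> and \<open>m \<le> \<bar>ln D\<bar> / ln (1 / \<rho>)\<close>. It is
  made for \<open>0 < D < 1\<close>; for \<open>D \<ge> 1\<close> already \<open>m = 0\<close> suffices. For \<open>D = 0\<close> one lets \<open>m\<close> tend to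
  infinity: then \<open>E \<le> 0\<close>, and the right-hand side is 0 because of its factor \<open>D\<close>, whatever the
  value of \<open>ln 0\<close>.
\<close>

lemma optimal_number_of_steps:
  fixes E D \<rho> C :: real
  assumes E: "\<And>m. E \<le> real m * D + C * \<rho> ^ m"
    and D: "0 \<le> D" and \<rho>: "0 < \<rho>" "\<rho> < 1" and C: "0 \<le> C"
  shows "E \<le> (C / \<rho> + \<bar>ln D\<bar> / ln (1 / \<rho>)) * D"
proof -
  consider "D = 0" | "0 < D" "D < 1" | "1 \<le> D" using D by linarith
  then show ?thesis
  proof cases
    case 1
    have "(\<lambda>m. C * \<rho> ^ m) \<longlonglongrightarrow> C * 0"
      using \<rho> by (intro tendsto_mult_left LIMSEQ_realpow_zero) auto
    then have "E \<le> C * 0"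
      using E 1 by (intro LIMSEQ_le_const[where X="\<lambda>m. C * \<rho> ^ m"]) auto
    then show ?thesis using 1 by simp
  next
    case 2
    define t where "t = ln D / ln \<rho>"
    have ln\<rho>: "ln \<rho> < 0" using \<rho> by simp
    have lnD: "ln D < 0" using 2 by simp
    have t0: "0 \<le> t" unfolding t_def using ln\<rho> lnD by (simp add: divide_nonpos_nonpos)
    have t: "t = \<bar>ln D\<bar> / ln (1 / \<rho>)" unfolding t_def using \<rho> lnD by (simp add: ln_div)
    define m where "m = nat \<lfloor>t\<rfloor>"
    have m: "real m \<le> t" "t \<le> real m + 1" unfolding m_def using t0 by linarith+
    have "real (Suc m) * ln \<rho> \<le> t * ln \<rho>"
      using m(2) ln\<rho> by (intro mult_right_mono_neg) auto
    also have "\<dots> = ln D" unfolding t_def using ln\<rho> by simp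
    finally have "ln (\<rho> ^ Suc m) \<le> ln D" using \<rho> by (subst ln_realpow) auto
    then have "\<rho> ^ Suc m \<le> D" using \<rho> 2 by (subst (asm) ln_le_cancel_iff) auto
    then have "\<rho> ^ m \<le> D / \<rho>" using \<rho> by (simp add: field_simps)
    then have "C * \<rho> ^ m \<le> C * (D / \<rho>)" using C by (rule mult_left_mono)
    moreover have "real m * D \<le> t * D" using m(1) D by (rule mult_right_mono)
    ultimately show ?thesis using E[of m] t by (simp add: algebra_simps)
  next
    case 3
    have "E \<le> C" using E[of 0] by simp
    also have "\<dots> \<le> C * (D / \<rho>)"
    proof -
      have "1 \<le> D / \<rho>" using 3 \<rho> by (simp add: le_divide_eq)
      from mult_left_mono[OF this C] show ?thesis by simp
    qed
    also have "\<dots> \<le> C * (D / \<rho>) + \<bar>ln D\<bar> / ln (1 / \<rho>) * D"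
      using 3 \<rho> by simp
    finally show ?thesis by (simp add: algebra_simps)
  qed
qed

text \<open>
  Ergodicity is stated for the unit ball with weight \<open>V\<close>, the distance of the kernels for the unit
  ball with weight 1; a function in the latter lies in both because \<open>V \<ge> 1\<close>. Both errors carry the
  factor \<open>\<nu>(V)\<close>, so dividing by it makes the optimal number of steps independent of \<open>\<nu>\<close>.
\<close>

lemma geom_ergodic_invariant_comparison:
  assumes K: "K \<in> M \<rightarrow>\<^sub>M subprob_algebra M" and Q: "Q \<in> M \<rightarrow>\<^sub>M subprob_algebra M"
    and inv: "invariant_measure M K \<nu>" and ne: "space M \<noteq> {}" and fin: "finite_measure \<nu>"
    and V1: "\<And>x. x \<in> space M \<Longrightarrow> 1 \<le> V x" and VI: "integrable \<nu> V"
    and erg: "geom_ergodic M V Q \<mu> \<psi> \<rho> C" and \<psi>: "integrable \<nu> \<psi>"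
    and f: "f \<in> wball M (\<lambda>_. 1)"
  defines "D \<equiv> enn2real (kdist M V K Q)"
  shows "cmod ((\<integral>x. f x \<partial>\<nu>) - (\<integral>x. f x \<partial>\<mu>) * of_real (\<integral>x. \<psi> x \<partial>\<nu>))
           \<le> (\<integral>x. V x \<partial>\<nu>) * ((C / \<rho> + \<bar>ln D\<bar> / ln (1 / \<rho>)) * D)"
proof -
  let ?v = "\<integral>x. V x \<partial>\<nu>" and ?c = "\<integral>x. f x \<partial>\<mu>"
  let ?E = "cmod ((\<integral>x. f x \<partial>\<nu>) - ?c * of_real (\<integral>x. \<psi> x \<partial>\<nu>))"
  have s: "sets \<nu> = sets M" using inv by (simp add: invariant_measure_def)
  have sp: "space \<nu> = space M" by (rule sets_eq_imp_space_eq[OF s])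
  have \<rho>: "0 < \<rho>" "\<rho> < 1" "0 < C" using erg by (auto simp: geom_ergodic_def)
  have V0: "\<And>x. x \<in> space M \<Longrightarrow> 0 < V x" using V1 by fastforce
  have fV: "f \<in> wball M V"
    using f V1 by (force simp: wball_1_iff wball_iff[OF V0] intro: order_trans)
  have v0: "0 \<le> ?v" using V0 by (intro Bochner_Integration.integral_nonneg) (auto simp: sp less_imp_le)
  have step: "?E \<le> real m * (?v * D) + (?v * C) * \<rho> ^ m" for m
  proof -
    let ?g = "(kact Q ^^ m) f"
    have ig: "integrable \<nu> ?g" by (rule wball_integrable[OF fin s kact_funpow_wball[OF Q f]])
    have i\<psi>: "integrable \<nu> (\<lambda>x. complex_of_real (\<psi> x))" using \<psi> by simp
    have "(\<integral>x. ?g x \<partial>\<nu>) - ?c * of_real (\<integral>x. \<psi> x \<partial>\<nu>)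
            = (\<integral>x. ?g x - ?c * of_real (\<psi> x) \<partial>\<nu>)"
      using ig i\<psi> by simp
    also have "cmod \<dots> \<le> (\<integral>x. C * \<rho> ^ m * V x \<partial>\<nu>)"
    proof (rule norm_integral_le_integral)
      show "cmod (?g x - ?c * of_real (\<psi> x)) \<le> C * \<rho> ^ m * V x" if "x \<in> space \<nu>" for x
      proof -
        have "wopnorm M V V (\<lambda>f x. (kact Q ^^ m) f x - (\<integral>y. f y \<partial>\<mu>) * complex_of_real (\<psi> x))
                \<le> ennreal (C * \<rho> ^ m)"
          using erg unfolding geom_ergodic_def by blast
        from wopnorm_le_imp[OF this fV] show ?thesis using that V0 \<rho> by (simp add: sp)
      qed
    qed (use ig i\<psi> VI in auto)
    finally have "cmod ((\<integral>x. ?g x \<partial>\<nu>) - ?c * of_real (\<integral>x. \<psi> x \<partial>\<nu>)) \<le> C * \<rho> ^ m * ?v" by simp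
    moreover have "cmod ((\<integral>x. f x \<partial>\<nu>) - (\<integral>x. ?g x \<partial>\<nu>)) \<le> real m * D * ?v"
      unfolding D_def by (rule invariant_measure_power_diff[OF K Q inv ne fin V1 VI f])
    ultimately show ?thesis
      using norm_triangle_ineq[of "(\<integral>x. f x \<partial>\<nu>) - (\<integral>x. ?g x \<partial>\<nu>)" "(\<integral>x. ?g x \<partial>\<nu>) - ?c * of_real (\<integral>x. \<psi> x \<partial>\<nu>)"]
      by (simp add: algebra_simps)
  qed
  show ?thesis
  proof (cases "?v = 0")
    case True
    then show ?thesis using step[of 0] by simp
  next
    case False
    then have v: "0 < ?v" using v0 by simp
    have "?E / ?v \<le> (C / \<rho> + \<bar>ln D\<bar> / ln (1 / \<rho>)) * D"
    proof (rule optimal_number_of_steps)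
      show "?E / ?v \<le> real m * D + C * \<rho> ^ m" for m
        using step[of m] v by (simp add: divide_le_eq algebra_simps)
    qed (use \<rho> in \<open>auto simp: D_def\<close>)
    then show ?thesis using v by (simp add: divide_le_eq mult.commute)
  qed
qed

text \<open>
  The common core of (a) and (b): \<open>\<nu>(V)\<close> is estimated by the drift inequality, and the constants
  \<open>C / \<rho>\<close> and 1 are relaxed to \<open>2 C / \<rho>\<close> and \<open>1 + L / (1 - \<delta>)\<close>. The mass of \<open>\<nu>\<close> is kept as a
  separate factor, so that it can be divided out when \<open>\<nu>\<close> is not a probability measure.
\<close>

lemma geom_ergodic_drift_comparison:
  assumes K: "K \<in> M \<rightarrow>\<^sub>M subprob_algebra M" and Q: "Q \<in> M \<rightarrow>\<^sub>M subprob_algebra M"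
    and inv: "invariant_measure M K \<nu>" and ne: "space M \<noteq> {}" and fin: "finite_measure \<nu>"
    and V: "V \<in> borel_measurable M" and V1: "\<And>x. x \<in> space M \<Longrightarrow> 1 \<le> V x"
    and VI: "(\<integral>\<^sup>+x. ennreal (V x) \<partial>\<nu>) < \<infinity>"
    and d: "0 \<le> \<delta>" "\<delta> < 1" and L: "0 \<le> L"
    and drift: "\<And>x. x \<in> space M \<Longrightarrow> (\<integral>\<^sup>+y. ennreal (V y) \<partial>K x) \<le> ennreal (\<delta> * V x + L)"
    and erg: "geom_ergodic M V Q \<mu> \<psi> \<rho> C" and \<psi>: "integrable \<nu> \<psi>"
    and f: "f \<in> wball M (\<lambda>_. 1)"
  defines "D \<equiv> enn2real (kdist M V K Q)"
  shows "cmod ((\<integral>x. f x \<partial>\<nu>) - (\<integral>x. f x \<partial>\<mu>) * of_real (\<integral>x. \<psi> x \<partial>\<nu>))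
           \<le> measure \<nu> (space M) *
               (L / (1 - \<delta>) * (2 * C / \<rho> + (1 + L / (1 - \<delta>)) / ln (1 / \<rho>) * \<bar>ln D\<bar>) * D)"
proof -
  have s: "sets \<nu> = sets M" using inv by (simp add: invariant_measure_def)
  have V0: "\<And>x. x \<in> space M \<Longrightarrow> 0 \<le> V x" using V1 by fastforce
  have \<rho>: "0 < \<rho>" "\<rho> < 1" "0 < C" using erg by (auto simp: geom_ergodic_def)
  have D0: "0 \<le> D" by (simp add: D_def)
  have ln0: "0 < ln (1 / \<rho>)" using \<rho> by simp
  have "\<bar>ln D\<bar> / ln (1 / \<rho>) \<le> (1 + L / (1 - \<delta>)) * (\<bar>ln D\<bar> / ln (1 / \<rho>))"
    using d L ln0 mult_right_mono[of 1 "1 + L / (1 - \<delta>)" "\<bar>ln D\<bar> / ln (1 / \<rho>)"] by simp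
  then have "C / \<rho> + \<bar>ln D\<bar> / ln (1 / \<rho>) \<le> 2 * C / \<rho> + (1 + L / (1 - \<delta>)) / ln (1 / \<rho>) * \<bar>ln D\<bar>"
    using \<rho> by (intro add_mono) (simp_all add: divide_right_mono)
  then have le: "(C / \<rho> + \<bar>ln D\<bar> / ln (1 / \<rho>)) * D
      \<le> (2 * C / \<rho> + (1 + L / (1 - \<delta>)) / ln (1 / \<rho>) * \<bar>ln D\<bar>) * D"
    using D0 by (rule mult_right_mono)
  have "cmod ((\<integral>x. f x \<partial>\<nu>) - (\<integral>x. f x \<partial>\<mu>) * of_real (\<integral>x. \<psi> x \<partial>\<nu>))
      \<le> (\<integral>x. V x \<partial>\<nu>) * ((C / \<rho> + \<bar>ln D\<bar> / ln (1 / \<rho>)) * D)"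
    unfolding D_def
    by (rule geom_ergodic_invariant_comparison[OF K Q inv ne fin V1 integrable_weight[OF s V V0 VI] erg \<psi> f])
  also have "\<dots> \<le> (L / (1 - \<delta>) * measure \<nu> (space M)) *
      ((2 * C / \<rho> + (1 + L / (1 - \<delta>)) / ln (1 / \<rho>) * \<bar>ln D\<bar>) * D)"
    using invariant_measure_drift[OF K inv ne fin V V0 VI d L drift] le d L D0 \<rho> ln0
    by (intro mult_mono[OF _ le]) auto
  finally show ?thesis by (simp only: ac_simps)
qed

section \<open>The total variation bounds\<close>

theorem proposition2p1:
  fixes M :: "'a measure"
    and V :: "'a \<Rightarrow> real"
    and x\<^sub>0 :: 'a
    and P :: "'a \<Rightarrow> 'a measure"
    and Ph :: "nat \<Rightarrow> 'a \<Rightarrow> 'a measure"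
    and \<pi> :: "'a measure"
    and \<pi>h :: "nat \<Rightarrow> 'a measure"
    and \<phi> :: "nat \<Rightarrow> 'a \<Rightarrow> real"
    and \<delta> L :: real
  defines "\<Delta> \<equiv> (\<lambda>k. enn2real (kdist M V (Ph k) P))"
    and "A \<equiv> 1 + L / (1 - \<delta>)"
  assumes V_meas: "V \<in> borel_measurable M"
    and V_ge_1: "\<And>x. x \<in> space M \<Longrightarrow> 1 \<le> V x"
    and V_x0: "x\<^sub>0 \<in> space M" "V x\<^sub>0 = 1"
    and P_Markov: "P \<in> M \<rightarrow>\<^sub>M prob_algebra M"
    and Ph_sub_Markov: "\<And>k. k \<ge> 1 \<Longrightarrow> Ph k \<in> M \<rightarrow>\<^sub>M subprob_algebra M"
    and PV_bounded: "(SUP x\<in>space M. (\<integral>\<^sup>+y. ennreal (V y) \<partial>P x) / ennreal (V x)) < \<infinity>"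
    and PhV_bounded: "\<And>k. k \<ge> 1 \<Longrightarrow>
          (SUP x\<in>space M. (\<integral>\<^sup>+y. ennreal (V y) \<partial>Ph k x) / ennreal (V x)) < \<infinity>"
    and pi_prob: "prob_space \<pi>"
    and pi_invariant: "invariant_measure M P \<pi>"
    and pi_V: "(\<integral>\<^sup>+x. ennreal (V x) \<partial>\<pi>) < \<infinity>"
    and pih_finite: "\<And>k. k \<ge> 1 \<Longrightarrow> finite_measure (\<pi>h k)"
    and pih_invariant: "\<And>k. k \<ge> 1 \<Longrightarrow> invariant_measure M (Ph k) (\<pi>h k)"
    and pih_V: "\<And>k. k \<ge> 1 \<Longrightarrow> (\<integral>\<^sup>+x. ennreal (V x) \<partial>\<pi>h k) < \<infinity>"
    and phi_meas: "\<And>k. k \<ge> 1 \<Longrightarrow> \<phi> k \<in> borel_measurable M"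
    and phi_nonneg: "\<And>k x. k \<ge> 1 \<Longrightarrow> x \<in> space M \<Longrightarrow> 0 \<le> \<phi> k x"
    and phi_bounded: "\<And>k. k \<ge> 1 \<Longrightarrow> bounded (\<phi> k ` space M)"
    and phi_fixed: "\<And>k x. k \<ge> 1 \<Longrightarrow> x \<in> space M \<Longrightarrow> kact (Ph k) (\<phi> k) x = \<phi> k x"
    and pih_phi: "\<And>k. k \<ge> 1 \<Longrightarrow> (\<integral>x. \<phi> k x \<partial>\<pi>h k) = 1"
    and Ph_finite_rank: "\<And>k. k \<ge> 1 \<Longrightarrow> finite_rank M V (kact (Ph k))"
    and Ph_lim: "(\<lambda>k. kdist M V (Ph k) P) \<longlonglongrightarrow> 0"
    and pi_phi_lim: "(\<lambda>k. \<integral>x. \<phi> k x \<partial>\<pi>) \<longlonglongrightarrow> 1"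
    and pih_1_lim: "(\<lambda>k. measure (\<pi>h k) (space M)) \<longlonglongrightarrow> 1"
    and delta: "0 < \<delta>" "\<delta> < 1"
    and L: "0 < L"
    and P_drift: "\<And>x. x \<in> space M \<Longrightarrow> (\<integral>\<^sup>+y. ennreal (V y) \<partial>P x) \<le> ennreal (\<delta> * V x + L)"
    and Ph_drift: "\<And>k x. k \<ge> 1 \<Longrightarrow> x \<in> space M \<Longrightarrow>
          (\<integral>\<^sup>+y. ennreal (V y) \<partial>Ph k x) \<le> ennreal (\<delta> * V x + L)"
  shows "(\<forall>k\<ge>1. \<forall>\<rho>\<^sub>k C\<^sub>k. geom_ergodic M V (Ph k) (\<pi>h k) (\<phi> k) \<rho>\<^sub>k C\<^sub>k \<longrightarrow>
            tv_norm_diff M (\<pi>h k) \<pi> \<le> ennreal (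
              measure (\<pi>h k) (space M) * \<bar>1 - (\<integral>x. \<phi> k x \<partial>\<pi>)\<bar>
              + L / (1 - \<delta>) * (2 * C\<^sub>k / \<rho>\<^sub>k + A / ln (1 / \<rho>\<^sub>k) * \<bar>ln (\<Delta> k)\<bar>) * \<Delta> k))
       \<and> (\<forall>\<rho> C. geom_ergodic M V P \<pi> (\<lambda>_. 1) \<rho> C \<longrightarrow>
            (\<forall>n\<ge>1. tv_norm_diff M (\<pi>h n) \<pi> \<le> ennreal (
              \<bar>1 - measure (\<pi>h n) (space M)\<bar>
              + L / (1 - \<delta>) * (2 * C / \<rho> + A / ln (1 / \<rho>) * \<bar>ln (\<Delta> n)\<bar>) * \<Delta> n)))"
proof -
  have ne: "space M \<noteq> {}" using V_x0 by auto
  have P: "P \<in> M \<rightarrow>\<^sub>M subprob_algebra M" by (rule measurable_prob_algebraD[OF P_Markov])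
  interpret \<pi>: prob_space \<pi> by (rule pi_prob)
  have s\<pi>: "sets \<pi> = sets M" using pi_invariant by (simp add: invariant_measure_def)
  have sp\<pi>: "space \<pi> = space M" by (rule sets_eq_imp_space_eq[OF s\<pi>])
  have mass_\<pi>: "measure \<pi> (space M) = 1" using \<pi>.prob_space sp\<pi> by simp
  have \<pi>h_bound: "cmod (\<integral>x. f x \<partial>\<pi>h k) \<le> measure (\<pi>h k) (space M)"
    if k: "k \<ge> 1" and f: "f \<in> wball M (\<lambda>_. 1)" for k f
  proof -
    interpret finite_measure "\<pi>h k" by (rule pih_finite[OF k])
    have s: "sets (\<pi>h k) = sets M" using pih_invariant[OF k] by (simp add: invariant_measure_def)
    have sp: "space (\<pi>h k) = space M" by (rule sets_eq_imp_space_eq[OF s])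
    have "cmod (\<integral>x. f x \<partial>\<pi>h k) \<le> (\<integral>x. 1 \<partial>\<pi>h k)"
      using f wball_integrable[OF finite_measure_axioms s f]
      by (intro norm_integral_le_integral) (auto simp: sp wball_1_iff)
    then show ?thesis by (simp add: sp)
  qed
  have tv_le: "tv_norm_diff M (\<pi>h k) \<pi> \<le> ennreal B"
    if "\<And>f. f \<in> wball M (\<lambda>_. 1) \<Longrightarrow> cmod ((\<integral>x. f x \<partial>\<pi>h k) - (\<integral>x. f x \<partial>\<pi>)) \<le> B" for k B
    unfolding tv_norm_diff_def using that by (intro SUP_least ennreal_leI)
  show ?thesis
  proof (intro conjI allI impI)
    fix k \<rho>\<^sub>k C\<^sub>k
    assume k: "1 \<le> k" and erg: "geom_ergodic M V (Ph k) (\<pi>h k) (\<phi> k) \<rho>\<^sub>k C\<^sub>k"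
    have \<phi>: "integrable \<pi> (\<phi> k)"
    proof -
      obtain b where "\<And>x. x \<in> space M \<Longrightarrow> norm (\<phi> k x) \<le> b"
        using phi_bounded[OF k] by (auto simp: bounded_iff)
      moreover have "\<phi> k \<in> borel_measurable \<pi>"
        using phi_meas[OF k] unfolding measurable_cong_sets[OF s\<pi> refl] .
      ultimately show ?thesis
        by (intro \<pi>.integrable_const_bound[where B=b] AE_I2) (simp_all add: sp\<pi>)
    qed
    let ?B = "L / (1 - \<delta>) * (2 * C\<^sub>k / \<rho>\<^sub>k + A / ln (1 / \<rho>\<^sub>k) * \<bar>ln (\<Delta> k)\<bar>) * \<Delta> k"
    show "tv_norm_diff M (\<pi>h k) \<pi>
        \<le> ennreal (measure (\<pi>h k) (space M) * \<bar>1 - (\<integral>x. \<phi> k x \<partial>\<pi>)\<bar> + ?B)"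
    proof (rule tv_le)
      fix f assume f: "f \<in> wball M (\<lambda>_. 1)"
      let ?p = "\<integral>x. f x \<partial>\<pi>" and ?h = "\<integral>x. f x \<partial>\<pi>h k" and ?c = "\<integral>x. \<phi> k x \<partial>\<pi>"
      have "cmod (?p - ?h * of_real ?c) \<le> ?B"
        using geom_ergodic_drift_comparison[OF P Ph_sub_Markov[OF k] pi_invariant ne
            \<pi>.finite_measure_axioms V_meas V_ge_1 pi_V less_imp_le[OF delta(1)] delta(2) less_imp_le[OF L]
            P_drift erg \<phi> f]
        by (simp add: mass_\<pi> A_def \<Delta>_def kdist_commute[of M V P])
      moreover have "cmod (?h * of_real (1 - ?c)) \<le> measure (\<pi>h k) (space M) * \<bar>1 - ?c\<bar>"
        using \<pi>h_bound[OF k f] by (simp only: norm_mult norm_of_real mult_right_mono abs_ge_zero)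
      moreover have "?h - ?p = ?h * of_real (1 - ?c) - (?p - ?h * of_real ?c)"
        by (simp add: algebra_simps)
      ultimately show "cmod (?h - ?p) \<le> measure (\<pi>h k) (space M) * \<bar>1 - ?c\<bar> + ?B"
        by (simp only:) (rule norm_triangle_le_diff[OF add_mono])
    qed
  next
    fix \<rho> C and n :: nat
    assume erg: "geom_ergodic M V P \<pi> (\<lambda>_. 1) \<rho> C" and n: "1 \<le> n"
    interpret h: finite_measure "\<pi>h n" by (rule pih_finite[OF n])
    have s: "sets (\<pi>h n) = sets M" using pih_invariant[OF n] by (simp add: invariant_measure_def)
    have sp: "space (\<pi>h n) = space M" by (rule sets_eq_imp_space_eq[OF s])
    let ?c = "measure (\<pi>h n) (space M)"
    let ?B = "L / (1 - \<delta>) * (2 * C / \<rho> + A / ln (1 / \<rho>) * \<bar>ln (\<Delta> n)\<bar>) * \<Delta> n"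
    have c: "0 < ?c"
    proof (rule ccontr)
      assume "\<not> 0 < ?c"
      then have "emeasure (\<pi>h n) (space (\<pi>h n)) = 0"
        by (simp add: h.emeasure_eq_measure sp zero_less_measure_iff)
      then have "AE x in \<pi>h n. \<phi> n x = 0"
        by (intro AE_I[of _ _ "space (\<pi>h n)"]) auto
      then have "(\<integral>x. \<phi> n x \<partial>\<pi>h n) = 0" by (rule integral_eq_zero_AE)
      with pih_phi[OF n] show False by simp
    qed
    show "tv_norm_diff M (\<pi>h n) \<pi> \<le> ennreal (\<bar>1 - ?c\<bar> + ?B)"
    proof (rule tv_le)
      fix f assume f: "f \<in> wball M (\<lambda>_. 1)"
      let ?p = "\<integral>x. f x \<partial>\<pi>" and ?h = "\<integral>x. f x \<partial>\<pi>h n"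
      have "cmod (?h - ?p * of_real ?c) \<le> ?c * ?B"
        using geom_ergodic_drift_comparison[OF Ph_sub_Markov[OF n] P pih_invariant[OF n] ne
            h.finite_measure_axioms V_meas V_ge_1 pih_V[OF n] less_imp_le[OF delta(1)] delta(2)
            less_imp_le[OF L] Ph_drift[OF n] erg _ f]
        by (simp add: A_def \<Delta>_def sp)
      moreover have "?h / of_real ?c - ?p = (?h - ?p * of_real ?c) / of_real ?c"
        using c by (simp add: field_simps)
      ultimately have "cmod (?h / of_real ?c - ?p) \<le> ?B"
        using c by (simp add: norm_divide divide_le_eq mult.commute)
      \<comment> \<open>The mass of the perturbed measure may be large, so the error in mass is split off the
        normalized integral \<open>?h / ?c\<close>; this keeps \<open>?B\<close> free of the factor \<open>?c\<close>.\<close>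
      moreover have "cmod (of_real (?c - 1) * (?h / of_real ?c)) \<le> \<bar>1 - ?c\<bar>"
      proof -
        have "cmod (?h / of_real ?c) \<le> 1"
          using \<pi>h_bound[OF n f] c by (simp add: norm_divide)
        from mult_left_mono[OF this, of "\<bar>?c - 1\<bar>"] show ?thesis
          by (simp only: norm_mult norm_of_real mult_1_right abs_minus_commute abs_ge_zero)
      qed
      moreover have "?h - ?p = of_real (?c - 1) * (?h / of_real ?c) + (?h / of_real ?c - ?p)"
        using c by (simp add: field_simps)
      ultimately show "cmod (?h - ?p) \<le> \<bar>1 - ?c\<bar> + ?B"
        by (simp only:) (rule norm_triangle_le[OF add_mono])
    qed
  qed
qed

end
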